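(* Let $n\ge 2$, let $P_n$ be the path on vertices $v_1,\dots,v_n$ with edges $v_iv_{i+1}$ ($1\le i\le n-1$), and let $G'_n$ be the graph obtained from $P_n$ by attaching one pendant vertex $\ell_i$ (adjacent only to $v_i$) to each internal vertex $v_i$ for $2\le i\le n-1$. Then $$\gamma(G'_n)=\max\{1,n-2\},\qquad \zeta(G'_n)=\begin{cases}2,& n=2,\\ 1,& n=3,\\ 2^{\gamma(G'_n)-2},& n\ge 4.\end{cases}$$
   Context: For a finite simple graph $G$, a set $D\subseteq V(G)$ is dominating if every vertex of $G$ lies in $D$ or has a neighbor in $D$. The domination number $\gamma(G)$ is the minimum size of a dominating set. The dominion $\zeta(G)$ is the number of dominating sets of $G$ of size $\gamma(G)$. *)

theory Defs
  imports "Graph_Theory.Pair_Digraph"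
begin

text \<open>
  Finite simple graphs are the symmetric loop-free finite digraphs of the locales \<open>graph\<close> and
  \<open>pair_graph\<close>; an edge \<open>uv\<close> is represented by the two arcs \<open>(u, v)\<close> and \<open>(v, u)\<close>.
\<close>

definition dominating_set :: "('a, 'b) pre_digraph \<Rightarrow> 'a set \<Rightarrow> bool" where
  "dominating_set G D \<longleftrightarrow>
     D \<subseteq> verts G \<and> (\<forall>v \<in> verts G. v \<in> D \<or> (\<exists>u \<in> D. u \<rightarrow>\<^bsub>G\<^esub> v))"

text \<open>
  Both numbers below are meaningful for finite graphs only. There \<open>verts G\<close> is itself dominating,
  so the minimum ranges over a finite nonempty set.
\<close>

definition domination_number :: "('a, 'b) pre_digraph \<Rightarrow> nat" where
  "domination_number G = Min (card ` {D. dominating_set G D})"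

definition dominion :: "('a, 'b) pre_digraph \<Rightarrow> nat" where
  "dominion G = card {D. dominating_set G D \<and> card D = domination_number G}"

definition path_graph :: "nat \<Rightarrow> nat pair_pre_digraph" where
  "path_graph n = \<lparr> pverts = {1..n},
     parcs = (\<Union>i \<in> {1..<n}. {(i, i + 1), (i + 1, i)}) \<rparr>"

datatype 'a pendant_vertex = Base 'a | Leaf 'a

definition attach_pendants :: "'a pair_pre_digraph \<Rightarrow> 'a set \<Rightarrow> 'a pendant_vertex pair_pre_digraph" where
  "attach_pendants G S = \<lparr> pverts = Base ` pverts G \<union> Leaf ` S,
     parcs = map_prod Base Base ` parcs G \<union>
             (\<Union>v \<in> S. {(Base v, Leaf v), (Leaf v, Base v)}) \<rparr>"

definition pendant_path :: "nat \<Rightarrow> nat pendant_vertex pair_pre_digraph" where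
  "pendant_path n = attach_pendants (path_graph n) {2..n - 1}"

lemma pair_graph_path_graph: "pair_graph (path_graph n)"
  by unfold_locales (auto simp: path_graph_def symmetric_def sym_def)

lemma pair_graph_attach_pendants:
  assumes "pair_graph G" "S \<subseteq> pverts G"
  shows "pair_graph (attach_pendants G S)"
proof -
  interpret G: pair_graph G by fact
  have S: "finite S"
    using assms(2) G.pair_finite_verts by (rule finite_subset)
  have sym: "(v, u) \<in> parcs G" if "(u, v) \<in> parcs G" for u v
    using G.pair_sym_arcs that by (auto simp: symmetric_def sym_def)
  show ?thesis
  proof unfold_locales
    show "symmetric (with_proj (attach_pendants G S))"
      by (auto simp: attach_pendants_def symmetric_def sym_def dest: sym intro: rev_image_eqI)
  qed (use assms(2) S G.pair_finite_verts G.pair_finite_arcs in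
        \<open>auto simp: attach_pendants_def dest: G.in_arcsD1 G.in_arcsD2 G.pair_no_loops\<close>)
qed

lemma pair_graph_pendant_path: "pair_graph (pendant_path n)"
  unfolding pendant_path_def
  by (rule pair_graph_attach_pendants[OF pair_graph_path_graph]) (auto simp: path_graph_def)

end

theory Submission
  imports Defs
begin

text \<open>
  A dominating set contains, for every vertex \<open>v\<close> carrying a pendant, \<open>v\<close> or its leaf. If the
  set \<open>S\<close> of these vertices dominates \<open>G\<close>, then the minimum dominating sets choose exactly one of
  the two for every \<open>v \<in> S\<close> and nothing else; such a choice is determined by the set \<open>A \<subseteq> S\<close> of
  vertices replaced by their leaves, and it dominates iff every vertex outside \<open>S\<close> keeps
  a neighbour in \<open>S - A\<close>. For the path the only vertices outside \<open>S\<close> are the two ends, so this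
  means that \<open>A\<close> avoids \<open>2\<close> and \<open>n - 1\<close>.
\<close>

text \<open>The coercion \<open>with_proj\<close> is inserted silently when a pair digraph is passed
  to \<open>dominating_set\<close>; this form works with \<open>pverts\<close> and
  \<open>parcs\<close> directly.\<close>

lemma dominating_set_with_proj:
  "dominating_set (with_proj G) D \<longleftrightarrow>
     D \<subseteq> pverts G \<and> (\<forall>v \<in> pverts G. v \<in> D \<or> (\<exists>u \<in> D. (u, v) \<in> parcs G))"
  by (auto simp: dominating_set_def arcs_ends_def arc_to_ends_def)

lemma finite_dominating_sets:
  assumes "finite (verts G)"
  shows "finite {D. dominating_set G D}"
  by (rule finite_subset[of _ "Pow (verts G)"]) (auto simp: dominating_set_def assms)

lemma domination_number_eqI:
  assumes "finite (verts G)" "dominating_set G D" "\<And>E. dominating_set G E \<Longrightarrow> card D \<le> card E"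
  shows "domination_number G = card D"
  unfolding domination_number_def
  by (rule Min_eqI) (use assms finite_dominating_sets[OF assms(1)] in auto)

section \<open>Pendants attached to an arbitrary graph\<close>

primrec pendant_base :: "'a pendant_vertex \<Rightarrow> 'a" where
  "pendant_base (Base v) = v"
| "pendant_base (Leaf v) = v"

definition pendant_choice :: "'a set \<Rightarrow> 'a set \<Rightarrow> 'a pendant_vertex set" where
  "pendant_choice S A = Base ` (S - A) \<union> Leaf ` A"

lemma mem_pendant_choice [simp]:
  "Base v \<in> pendant_choice S A \<longleftrightarrow> v \<in> S - A"
  "Leaf v \<in> pendant_choice S A \<longleftrightarrow> v \<in> A"
  by (auto simp: pendant_choice_def)

text \<open>\<open>A\<close> can be read off from the leaves in the choice.\<close>

lemma inj_pendant_choice: "inj (pendant_choice S)"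
  by (rule injI) (metis mem_pendant_choice(2) subsetI subset_antisym)

lemma card_pendant_choice:
  assumes "finite S" "A \<subseteq> S"
  shows "card (pendant_choice S A) = card S"
proof -
  have "bij_betw pendant_base (pendant_choice S A) S"
    using assms(2) by (auto simp: bij_betw_def inj_on_def pendant_choice_def image_Un image_image)
  then show ?thesis
    by (rule bij_betw_same_card)
qed

lemma parcs_attach_pendants [simp]:
  "(Base u, Base v) \<in> parcs (attach_pendants G S) \<longleftrightarrow> (u, v) \<in> parcs G"
  "(Leaf u, Base v) \<in> parcs (attach_pendants G S) \<longleftrightarrow> u = v \<and> v \<in> S"
  "(Base u, Leaf v) \<in> parcs (attach_pendants G S) \<longleftrightarrow> u = v \<and> v \<in> S"
  "(Leaf u, Leaf v) \<notin> parcs (attach_pendants G S)"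
  by (auto simp: attach_pendants_def)

lemma pverts_attach_pendants [simp]:
  "Base v \<in> pverts (attach_pendants G S) \<longleftrightarrow> v \<in> pverts G"
  "Leaf v \<in> pverts (attach_pendants G S) \<longleftrightarrow> v \<in> S"
  by (auto simp: attach_pendants_def)

text \<open>The only neighbour of \<open>Leaf v\<close> is \<open>Base v\<close>.\<close>

lemma dominating_set_meets_pendant:
  assumes "dominating_set (attach_pendants G S) D" "v \<in> S"
  shows "Base v \<in> D \<or> Leaf v \<in> D"
proof -
  have "Leaf v \<in> pverts (attach_pendants G S)"
    using assms(2) by simp
  then have "Leaf v \<in> D \<or> (\<exists>u\<in>D. (u, Leaf v) \<in> parcs (attach_pendants G S))"
    using assms(1) unfolding dominating_set_with_proj by blast
  then show ?thesis
    by (metis parcs_attach_pendants(3,4) pendant_vertex.exhaust)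
qed

text \<open>Source of the lower bound: for finite \<open>D\<close> it yields
  \<open>card S \<le> card D\<close>.\<close>

lemma pendants_subset_base_dominating_set:
  assumes "dominating_set (attach_pendants G S) D"
  shows "S \<subseteq> pendant_base ` D"
  using dominating_set_meets_pendant[OF assms] by (metis image_eqI pendant_base.simps subsetI)

text \<open>For \<open>v\<close> in \<open>S\<close>, whichever of \<open>Base v\<close> and
  \<open>Leaf v\<close> is chosen dominates the other. Only vertices outside \<open>S\<close> impose
  a condition; they carry no leaf, so they need a neighbour \<open>Base u\<close> in the
  choice.\<close>

lemma dominating_set_pendant_choice:
  assumes "S \<subseteq> pverts G" "A \<subseteq> S"
  shows "dominating_set (attach_pendants G S) (pendant_choice S A) \<longleftrightarrow>
    (\<forall>v \<in> pverts G - S. \<exists>u \<in> S - A. (u, v) \<in> parcs G)" (is "?L \<longleftrightarrow> ?R")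
proof
  assume L: ?L
  show ?R
  proof
    fix v assume v: "v \<in> pverts G - S"
    then have "Base v \<in> pverts (attach_pendants G S)" "Base v \<notin> pendant_choice S A"
      by auto
    then obtain u where "u \<in> pendant_choice S A" "(u, Base v) \<in> parcs (attach_pendants G S)"
      using L unfolding dominating_set_with_proj by blast
    then show "\<exists>u \<in> S - A. (u, v) \<in> parcs G"
      using v by (cases u) auto
  qed
next
  assume R: ?R
  have "w \<in> pendant_choice S A \<or>
      (\<exists>u \<in> pendant_choice S A. (u, w) \<in> parcs (attach_pendants G S))"
    if w: "w \<in> pverts (attach_pendants G S)" for w
  proof (cases w)
    case (Base v)
    consider "v \<in> S - A" | "v \<in> A" | "v \<in> pverts G - S"
      using w Base by auto
    then show ?thesis
    proof cases
      case 2
      then have "Leaf v \<in> pendant_choice S A"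
        "(Leaf v, w) \<in> parcs (attach_pendants G S)"
        using assms(2) Base by auto
      then show ?thesis by blast
    next
      case 3
      then obtain u where "u \<in> S - A" "(u, v) \<in> parcs G"
        using R by blast
      then have "Base u \<in> pendant_choice S A"
        "(Base u, w) \<in> parcs (attach_pendants G S)"
        using Base by auto
      then show ?thesis by blast
    qed (simp add: Base)
  next
    case (Leaf v)
    show ?thesis
    proof (cases "v \<in> A")
      case False
      then have "Base v \<in> pendant_choice S A"
        "(Base v, w) \<in> parcs (attach_pendants G S)"
        using w Leaf by auto
      then show ?thesis by blast
    qed (simp add: Leaf)
  qed
  moreover have "pendant_choice S A \<subseteq> pverts (attach_pendants G S)"
    using assms by (auto simp: pendant_choice_def)
  ultimately show ?L
    unfolding dominating_set_with_proj by blast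
qed

text \<open>Equality in the lower bound makes \<open>pendant_base\<close> a bijection from
  \<open>D\<close> onto \<open>S\<close>: nothing lies over a vertex outside \<open>S\<close>, and
  exactly one element over each vertex of \<open>S\<close>.\<close>

lemma minimum_dominating_set_is_choice:
  assumes "finite D" "dominating_set (attach_pendants G S) D" "card D = card S"
  obtains A where "A \<subseteq> S" "D = pendant_choice S A"
proof
  have img: "pendant_base ` D = S"
    \<comment> \<open>\<open>S\<close> lies in the image, whose size is at most
      \<open>card D = card S\<close>.\<close>
    using pendants_subset_base_dominating_set[OF assms(2)] assms(1,3)
    by (intro card_seteq[symmetric]) (auto simp: card_image_le simp flip: assms(3))
  then have inj: "inj_on pendant_base D"
    using assms(1,3) by (intro eq_card_imp_inj_on) simp_all
  define A where "A = {v. Leaf v \<in> D}"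
  have in_S: "pendant_base w \<in> S" if "w \<in> D" for w
    using img that by blast
  show "A \<subseteq> S"
    using in_S[of "Leaf _"] by (auto simp: A_def)
  have base: "Base v \<in> D \<longleftrightarrow> v \<in> S - A" for v
  proof
    assume v: "Base v \<in> D"
    then have "v \<in> S"
      using in_S[of "Base v"] by simp
    moreover have "Leaf v \<notin> D"
      using inj_onD[OF inj, of "Base v" "Leaf v"] v by auto
    ultimately show "v \<in> S - A"
      by (simp add: A_def)
  qed (use dominating_set_meets_pendant[OF assms(2)] in \<open>auto simp: A_def\<close>)
  show "D = pendant_choice S A"
  proof (rule set_eqI)
    fix w show "w \<in> D \<longleftrightarrow> w \<in> pendant_choice S A"
      by (cases w) (simp_all add: base, simp add: A_def)
  qed
qed

text \<open>The lower bound is attained by the choice without leaves, the copy of \<open>S\<close>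
  itself.\<close>

lemma domination_number_attach_pendants:
  assumes "pair_graph G" "dominating_set G S"
  shows "domination_number (attach_pendants G S) = card S"
proof -
  have S: "S \<subseteq> pverts G"
    using assms(2) by (simp add: dominating_set_with_proj)
  interpret H: pair_graph "attach_pendants G S"
    using assms(1) S by (rule pair_graph_attach_pendants)
  interpret G: pair_graph G by fact
  have fin: "finite S"
    using S G.pair_finite_verts by (rule finite_subset)
  have "dominating_set (attach_pendants G S) (pendant_choice S {})"
    using assms(2) by (subst dominating_set_pendant_choice[OF S]) (auto simp: dominating_set_with_proj)
  moreover have "card S \<le> card E" if "dominating_set (attach_pendants G S) E" for E
  proof -
    have "finite E"
      using that H.pair_finite_verts by (auto simp: dominating_set_with_proj intro: finite_subset)
    then show ?thesis
      using pendants_subset_base_dominating_set[OF that] by (rule surj_card_le)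
  qed
  ultimately have "domination_number (attach_pendants G S) = card (pendant_choice S {})"
    by (intro domination_number_eqI) (auto simp: card_pendant_choice fin H.pair_finite_verts)
  then show ?thesis
    by (simp add: card_pendant_choice fin)
qed

text \<open>\<open>pendant_choice S\<close> maps the admissible sets \<open>A\<close> bijectively
  onto the minimum dominating sets.\<close>

lemma dominion_attach_pendants:
  assumes "pair_graph G" "dominating_set G S"
  shows "dominion (attach_pendants G S) =
    card {A. A \<subseteq> S \<and> (\<forall>v \<in> pverts G - S. \<exists>u \<in> S - A. (u, v) \<in> parcs G)}" (is "_ = card ?A")
proof -
  have S: "S \<subseteq> pverts G"
    using assms(2) by (simp add: dominating_set_with_proj)
  interpret H: pair_graph "attach_pendants G S"
    using assms(1) S by (rule pair_graph_attach_pendants)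
  interpret G: pair_graph G by fact
  have fin: "finite S"
    using S G.pair_finite_verts by (rule finite_subset)
  have "{D. dominating_set (attach_pendants G S) D \<and> card D = card S} = pendant_choice S ` ?A"
  proof (intro equalityI subsetI)
    fix D assume "D \<in> {D. dominating_set (attach_pendants G S) D \<and> card D = card S}"
    then have D: "dominating_set (attach_pendants G S) D" "card D = card S"
      by auto
    moreover have "finite D"
      using D(1) H.pair_finite_verts by (auto simp: dominating_set_with_proj intro: finite_subset)
    ultimately obtain A where "A \<subseteq> S" "D = pendant_choice S A"
      using minimum_dominating_set_is_choice by blast
    then show "D \<in> pendant_choice S ` ?A"
      using D(1) dominating_set_pendant_choice[OF S] by blast
  next
    fix D assume "D \<in> pendant_choice S ` ?A"
    then show "D \<in> {D. dominating_set (attach_pendants G S) D \<and> card D = card S}"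
      using dominating_set_pendant_choice[OF S] card_pendant_choice[OF fin] by auto
  qed
  then show ?thesis
    unfolding dominion_def domination_number_attach_pendants[OF assms]
    by (simp add: card_image inj_on_subset[OF inj_pendant_choice])
qed

section \<open>The path with at least three vertices\<close>

lemma parcs_path_graph:
  "(u, v) \<in> parcs (path_graph n) \<longleftrightarrow>
     u \<in> {1..n} \<and> v \<in> {1..n} \<and> (v = u + 1 \<or> u = v + 1)"
  by (auto simp: path_graph_def)

lemma pverts_path_graph [simp]: "pverts (path_graph n) = {1..n}"
  by (simp add: path_graph_def)

text \<open>The ends are dominated by \<open>2\<close> and \<open>n - 1\<close>, which are internal
  for \<open>n \<ge> 3\<close> and coincide for \<open>n = 3\<close>.\<close>

lemma dominating_set_path_interior:
  assumes "n \<ge> 3"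
  shows "dominating_set (path_graph n) {2..n - 1}"
proof -
  have "v \<in> {2..n - 1} \<or> (\<exists>u \<in> {2..n - 1}. (u, v) \<in> parcs (path_graph n))" if "v \<in> {1..n}" for v
  proof -
    consider "v = 1" | "v = n" | "v \<in> {2..n - 1}"
      using \<open>v \<in> {1..n}\<close> by fastforce
    then show ?thesis
    proof cases
      case 1
      then show ?thesis
        using assms by (intro disjI2 bexI[of _ 2]) (auto simp: parcs_path_graph)
    next
      case 2
      then show ?thesis
        using assms by (intro disjI2 bexI[of _ "n - 1"]) (auto simp: parcs_path_graph)
    qed simp
  qed
  then show ?thesis
    by (auto simp: dominating_set_with_proj)
qed

lemma domination_number_pendant_path:
  assumes "n \<ge> 3"
  shows "domination_number (pendant_path n) = n - 2"
  unfolding pendant_path_def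
  using domination_number_attach_pendants[OF pair_graph_path_graph
      dominating_set_path_interior[OF assms]] by simp

text \<open>The end \<open>1\<close> forces \<open>2\<close> to be kept and the end \<open>n\<close>
  forces \<open>n - 1\<close>; the choice at the remaining internal vertices
  \<open>{3..n - 2}\<close> is free. For \<open>n = 3\<close> this interval is empty and the
  exponent truncates to \<open>0\<close>.\<close>

lemma dominion_pendant_path:
  assumes "n \<ge> 3"
  shows "dominion (pendant_path n) = 2 ^ (n - 4)"
proof -
  have ends: "{1..n} - {2..n - 1} = {1, n}"
    using assms by auto
  have left: "(u, 1) \<in> parcs (path_graph n) \<longleftrightarrow> u = 2" for u
    using assms by (auto simp: parcs_path_graph)
  have right: "(u, n) \<in> parcs (path_graph n) \<longleftrightarrow> u = n - 1" for u
    using assms by (auto simp: parcs_path_graph)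
  have "{A. A \<subseteq> {2..n - 1} \<and>
      (\<forall>v \<in> {1..n} - {2..n - 1}. \<exists>u \<in> {2..n - 1} - A. (u, v) \<in> parcs (path_graph n))} =
    {A. A \<subseteq> {2..n - 1} \<and> 2 \<notin> A \<and> n - 1 \<notin> A}"
    \<comment> \<open>Without \<open>One_nat_def\<close> the numeral \<open>1\<close> stays intact,
      so that \<open>left\<close> matches.\<close>
    unfolding ends using assms by (auto simp: left right simp del: One_nat_def)
  also have "\<dots> = Pow ({2..n - 1} - {2, n - 1})"
    by blast
  also have "{2..n - 1} - {2, n - 1} = {3..n - 2}"
    by auto
  finally show ?thesis
    using dominion_attach_pendants[OF pair_graph_path_graph dominating_set_path_interior[OF assms]]
    by (simp add: pendant_path_def card_Pow)
qed

section \<open>The path with two vertices\<close>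

lemma dominating_set_pendant_path_2:
  "dominating_set (pendant_path 2) D \<longleftrightarrow> D \<noteq> {} \<and> D \<subseteq> {Base 1, Base 2}"
proof -
  have "{1..<2::nat} = {1}" "{1..2::nat} = {1, 2}"
    by auto
  \<comment> \<open>There is no internal vertex, hence no leaf: the graph is a single edge.\<close>
  then have verts: "pverts (pendant_path 2) = {Base 1, Base 2}"
    and arcs: "parcs (pendant_path 2) = {(Base 1, Base 2), (Base 2, Base 1)}"
    by (simp_all add: pendant_path_def attach_pendants_def path_graph_def eval_nat_numeral)
  show ?thesis
  proof (cases "D \<subseteq> {Base 1, Base 2}")
    case True
    then have "D \<in> Pow {Base 1, Base 2}"
      by (rule PowI)
    then consider "D = {}" | "D = {Base 1}" | "D = {Base 2}" | "D = {Base 1, Base 2}"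
      unfolding Pow_insert Pow_empty by auto
    then show ?thesis
      by cases (auto simp: dominating_set_with_proj verts arcs)
  qed (simp add: dominating_set_with_proj verts)
qed

lemma domination_number_pendant_path_2: "domination_number (pendant_path 2) = 1"
proof -
  interpret pair_graph "pendant_path 2"
    by (rule pair_graph_pendant_path)
  have "domination_number (pendant_path 2) = card {Base 1 :: nat pendant_vertex}"
  proof (rule domination_number_eqI)
    fix E assume "dominating_set (pendant_path 2) E"
    then have "finite E" "E \<noteq> {}"
      by (auto simp: dominating_set_pendant_path_2 intro: finite_subset)
    then show "card {Base 1 :: nat pendant_vertex} \<le> card E"
      by (simp add: Suc_le_eq card_gt_0_iff)
  qed (auto simp: dominating_set_pendant_path_2)
  then show ?thesis
    by simp
qed

lemma dominion_pendant_path_2: "dominion (pendant_path 2) = 2"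
proof -
  have "{D. dominating_set (pendant_path 2) D \<and> card D = 1} = {{Base 1}, {Base 2}}"
    by (auto simp: dominating_set_pendant_path_2 card_1_singleton_iff)
  then show ?thesis
    by (simp add: dominion_def domination_number_pendant_path_2)
qed

theorem theorem6:
  fixes n :: nat
  assumes "n \<ge> 2"
  shows "domination_number (pendant_path n) = max 1 (n - 2) \<and>
    dominion (pendant_path n) =
      (if n = 2 then 2
       else if n = 3 then 1
       else 2 ^ (domination_number (pendant_path n) - 2))"
proof (cases "n = 2")
  case True
  then show ?thesis
    by (simp add: domination_number_pendant_path_2 dominion_pendant_path_2)
next
  case False
  then show ?thesis
    \<comment> \<open>Now \<open>n \<ge> 3\<close>, so the maximum is \<open>n - 2\<close>, and
      \<open>n - 4\<close> is \<open>(n - 2) - 2\<close>.\<close>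
    using assms by (simp add: domination_number_pendant_path dominion_pendant_path)
qed

end
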